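(* Let $G$ be a finite $2$-group. Assume $G$ admits a subnormal series $G=G_0>G_1>\cdots>G_{r-1}>G_r=1$ (strict inclusions) with $r\ge 1$, $G_i\trianglelefteq G_{i-1}$ and $Q_i=G_{i-1}/G_i$ for $i=1,\dots,r$, such that every $Q_i$ is abelian. Let $I\subseteq\{2,\dots,r\}$ be the set of those $k$ for which $Q_k$ has a subgroup isomorphic to $C_{e_k}\times C_{e_k}$, where $e_k=\exp Q_k$. Then $$\exp \mathrm{M}(G)\quad\text{divides}\quad 2^{|I|}\cdot\prod_{j=2}^{r}\exp Q_j\cdot\exp \mathrm{M}(Q_1).$$
   Context: $\mathrm{M}(G)=H^2(G,\mathbb{C}^\times)$ (trivial action) is the Schur multiplier of the finite group $G$; $\exp$ is the exponent; $C_n$ is the cyclic group of order $n$. *)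

theory Defs
  imports Complex_Main "HOL-Algebra.Algebra"
begin

text \<open>The least common multiple of the element orders, which is 0 when there is no positive
  common exponent (infinite order is \<open>ord = 0\<close>, and the LCM of an unbounded set is 0).\<close>

definition group_exponent :: "('a, 'b) monoid_scheme \<Rightarrow> nat" where
  "group_exponent G = (LCM x\<in>carrier G. group.ord G x)"

lemma (in group) group_exponent_dvd_iff:
  "group_exponent G dvd n \<longleftrightarrow> (\<forall>x\<in>carrier G. x [^] n = \<one>)"
  unfolding group_exponent_def by (simp add: Lcm_dvd_iff pow_eq_id)

definition complex_units :: "complex monoid" where
  "complex_units = \<lparr>carrier = - {0}, monoid.mult = (*), one = 1\<rparr>"

lemma comm_group_complex_units: "comm_group complex_units"
proof (rule comm_groupI)
  fix x assume "x \<in> carrier complex_units"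
  then show "\<exists>y\<in>carrier complex_units. y \<otimes>\<^bsub>complex_units\<^esub> x = \<one>\<^bsub>complex_units\<^esub>"
    by (intro bexI[of _ "inverse x"]) (auto simp: complex_units_def)
qed (auto simp: complex_units_def)

text \<open>Inhomogeneous, not necessarily normalised, cochains with trivial action. Cochains are
  extensional functions, so that equality of cochains is equality on the group.\<close>

definition cochains2 :: "('a, 'b) monoid_scheme \<Rightarrow> ('a \<times> 'a \<Rightarrow> complex) monoid" where
  "cochains2 G = product_group (carrier G \<times> carrier G) (\<lambda>_. complex_units)"

definition cocycles2 :: "('a, 'b) monoid_scheme \<Rightarrow> ('a \<times> 'a \<Rightarrow> complex) set" where
  "cocycles2 G = {f \<in> carrier (cochains2 G).
     \<forall>x\<in>carrier G. \<forall>y\<in>carrier G. \<forall>z\<in>carrier G.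
       f (y, z) * f (x, y \<otimes>\<^bsub>G\<^esub> z) = f (x \<otimes>\<^bsub>G\<^esub> y, z) * f (x, y)}"

definition coboundary1 ::
  "('a, 'b) monoid_scheme \<Rightarrow> ('a \<Rightarrow> complex) \<Rightarrow> 'a \<times> 'a \<Rightarrow> complex" where
  "coboundary1 G c =
     (\<lambda>(x, y)\<in>carrier G \<times> carrier G. c x * c y / c (x \<otimes>\<^bsub>G\<^esub> y))"

definition coboundaries2 :: "('a, 'b) monoid_scheme \<Rightarrow> ('a \<times> 'a \<Rightarrow> complex) set" where
  "coboundaries2 G =
     coboundary1 G ` carrier (product_group (carrier G) (\<lambda>_. complex_units))"

definition schur_multiplier ::
  "('a, 'b) monoid_scheme \<Rightarrow> ('a \<times> 'a \<Rightarrow> complex) set monoid" where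
  "schur_multiplier G = (cochains2 G)\<lparr>carrier := cocycles2 G\<rparr> Mod coboundaries2 G"

lemma group_cochains2: "group (cochains2 G)"
  unfolding cochains2_def
  by (simp add: comm_group.axioms comm_group_complex_units)

lemma mult_cochains2 [simp]:
  "f \<otimes>\<^bsub>cochains2 G\<^esub> g = (\<lambda>p\<in>carrier G \<times> carrier G. f p * g p)"
  by (simp add: cochains2_def complex_units_def)

lemma one_cochains2 [simp]:
  "\<one>\<^bsub>cochains2 G\<^esub> = (\<lambda>p\<in>carrier G \<times> carrier G. 1)"
  by (simp add: cochains2_def complex_units_def)

lemma comm_group_cochains2: "comm_group (cochains2 G)"
  by (rule group.group_comm_groupI[OF group_cochains2]) (simp add: mult.commute)

lemma inv_cochains2:
  assumes "f \<in> carrier (cochains2 G)"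
  shows "inv\<^bsub>cochains2 G\<^esub> f = (\<lambda>p\<in>carrier G \<times> carrier G. inverse (f p))"
  by (rule group.inv_equality[OF group_cochains2])
     (use assms in \<open>auto simp: cochains2_def complex_units_def PiE_iff fun_eq_iff\<close>)

lemma (in group) subgroup_cocycles2: "subgroup (cocycles2 G) (cochains2 G)"
proof (rule group.subgroupI[OF group_cochains2])
  show "cocycles2 G \<subseteq> carrier (cochains2 G)"
    by (auto simp: cocycles2_def)
  have "\<one>\<^bsub>cochains2 G\<^esub> \<in> cocycles2 G"
    using group.is_monoid[OF group_cochains2, THEN monoid.one_closed, of G]
    by (auto simp: cocycles2_def)
  then show "cocycles2 G \<noteq> {}" by blast
next
  fix f assume f: "f \<in> cocycles2 G"
  then have fc: "f \<in> carrier (cochains2 G)" by (simp add: cocycles2_def)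
  show "inv\<^bsub>cochains2 G\<^esub> f \<in> cocycles2 G"
    using f group.inv_closed[OF group_cochains2 fc]
    by (simp add: cocycles2_def inv_cochains2[OF fc] flip: inverse_mult_distrib)
next
  fix f g assume fg: "f \<in> cocycles2 G" "g \<in> cocycles2 G"
  then have "f \<otimes>\<^bsub>cochains2 G\<^esub> g \<in> carrier (cochains2 G)"
    using monoid.m_closed[OF group.is_monoid[OF group_cochains2]]
    unfolding cocycles2_def by blast
  moreover have "f (y, z) * g (y, z) * (f (x, y \<otimes> z) * g (x, y \<otimes> z)) =
      f (x \<otimes> y, z) * g (x \<otimes> y, z) * (f (x, y) * g (x, y))"
    if "x \<in> carrier G" "y \<in> carrier G" "z \<in> carrier G" for x y z
  proof -
    have "f (y, z) * f (x, y \<otimes> z) = f (x \<otimes> y, z) * f (x, y)"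
      "g (y, z) * g (x, y \<otimes> z) = g (x \<otimes> y, z) * g (x, y)"
      using fg that by (auto simp: cocycles2_def)
    then have "(f (y, z) * f (x, y \<otimes> z)) * (g (y, z) * g (x, y \<otimes> z)) =
        (f (x \<otimes> y, z) * f (x, y)) * (g (x \<otimes> y, z) * g (x, y))"
      by (rule arg_cong2)
    then show ?thesis by (simp only: mult_ac)
  qed
  ultimately show "f \<otimes>\<^bsub>cochains2 G\<^esub> g \<in> cocycles2 G"
    by (simp add: cocycles2_def)
qed

lemma (in group) coboundary1_cocycle:
  assumes "c \<in> carrier (product_group (carrier G) (\<lambda>_. complex_units))"
  shows "coboundary1 G c \<in> cocycles2 G"
proof -
  have nz: "c x \<noteq> 0" if "x \<in> carrier G" for x
    using assms that by (auto simp: complex_units_def)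
  then show ?thesis
    by (auto simp: cocycles2_def coboundary1_def cochains2_def complex_units_def m_assoc)
qed

lemma (in group) subgroup_coboundaries2:
  "subgroup (coboundaries2 G) ((cochains2 G)\<lparr>carrier := cocycles2 G\<rparr>)"
proof -
  let ?C = "product_group (carrier G) (\<lambda>_. complex_units)"
  let ?Z = "(cochains2 G)\<lparr>carrier := cocycles2 G\<rparr>"
  have C: "group ?C" by (simp add: comm_group.axioms comm_group_complex_units)
  have Z: "group ?Z"
    by (rule subgroup.subgroup_is_group[OF subgroup_cocycles2 group_cochains2])
  have "coboundary1 G \<in> hom ?C ?Z"
  proof (rule homI)
    fix c assume "c \<in> carrier ?C"
    then show "coboundary1 G c \<in> carrier ?Z"
      using coboundary1_cocycle by simp
  qed (auto simp: coboundary1_def complex_units_def fun_eq_iff)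
  then have "group_hom ?C ?Z (coboundary1 G)"
    using C Z by (simp add: group_hom_def group_hom_axioms_def)
  from group_hom.img_is_subgroup[OF this] show ?thesis
    by (simp only: coboundaries2_def)
qed

lemma (in group) comm_group_schur_multiplier: "comm_group (schur_multiplier G)"
proof -
  have "comm_group ((cochains2 G)\<lparr>carrier := cocycles2 G\<rparr>)"
    by (rule group.group_comm_groupI
          [OF subgroup.subgroup_is_group[OF subgroup_cocycles2 group_cochains2]])
       (simp add: mult.commute)
  then show ?thesis
    unfolding schur_multiplier_def
    by (rule comm_group.abelian_FactGroup[OF _ subgroup_coboundaries2])
qed

definition series_factor ::
  "('a, 'b) monoid_scheme \<Rightarrow> (nat \<Rightarrow> 'a set) \<Rightarrow> nat \<Rightarrow> 'a set monoid" where
  "series_factor G N i = (G\<lparr>carrier := N (i - 1)\<rparr>) Mod N i"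

end

theory Submission
  imports Defs
begin

text \<open>Let \<open>E\<close> be the central extension of \<open>G\<close> by the nonzero complex numbers given by a 2-cocycle
  \<open>f\<close>, and \<open>M i\<close> the preimage of \<open>N i\<close> in \<open>E\<close>. Climbing up the series, for suitable \<open>n i\<close> the
  map \<open>x \<mapsto> x ^ n i\<close> is a homomorphism from \<open>M i\<close> to the kernel of \<open>E \<rightarrow> G\<close>. Being a power map
  with central values it is invariant under conjugation by all of \<open>E\<close>, although \<open>N i\<close> need not be
  normal in \<open>G\<close>. In the step from \<open>M i\<close> to \<open>M (i - 1)\<close> the defect is the alternating form
  \<open>B x y = [x, y] ^ n i\<close> on \<open>N (i - 1) / N i\<close> raised to \<open>q choose 2\<close>; it vanishes for \<open>q = 2 e\<close>,
  and already for \<open>q = e\<close> unless some value of \<open>B\<close> has order \<open>e\<close>, in which case the quotient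
  contains the square of a cyclic group of order \<open>e\<close>. The homomorphism obtained on \<open>M 1\<close> shows
  that \<open>f ^ n 1\<close> is cohomologous to a cocycle inflated from \<open>G / N 1\<close>.\<close>

section \<open>Power maps with central values\<close>

context group
begin

lemma mult_inv_cancel_left [simp]:
  assumes "x \<in> carrier G" "y \<in> carrier G"
  shows "x \<otimes> (inv x \<otimes> y) = y" "inv x \<otimes> (x \<otimes> y) = y"
  using assms by (simp_all flip: m_assoc)

lemma conj_nat_pow:
  assumes "x \<in> carrier G" "y \<in> carrier G"
  shows "(y \<otimes> x \<otimes> inv y) [^] (n::nat) = y \<otimes> x [^] n \<otimes> inv y"
  using assms by (induction n) (simp_all add: m_assoc)

end

text \<open>In the application \<open>H\<close> and \<open>K\<close> are the preimages, in the
  central extension, of consecutive terms of the series. \<open>pow_commute\<close> and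
  \<open>pow_mult_K\<close> make the power map on \<open>K\<close> a homomorphism whose values
  commute with \<open>H\<close>; nothing else about the central kernel enters here.\<close>

locale central_power_map = group +
  fixes H K and n :: nat
  assumes subgroup_H: "subgroup H G" and subgroup_K: "subgroup K G" and K_le_H: "K \<subseteq> H"
    and conj_mem: "\<lbrakk>h \<in> H; k \<in> K\<rbrakk> \<Longrightarrow> h \<otimes> k \<otimes> inv h \<in> K"
    and commutator_mem: "\<lbrakk>x \<in> H; y \<in> H\<rbrakk> \<Longrightarrow> x \<otimes> y \<otimes> inv x \<otimes> inv y \<in> K"
    and pow_commute: "\<lbrakk>k \<in> K; h \<in> H\<rbrakk> \<Longrightarrow> h \<otimes> k [^] n = k [^] n \<otimes> h"
    and pow_mult_K: "\<lbrakk>k \<in> K; l \<in> K\<rbrakk> \<Longrightarrow> (k \<otimes> l) [^] n = k [^] n \<otimes> l [^] n"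
begin

section \<open>The alternating commutator form and its defect term\<close>

definition B where "B x y = (x \<otimes> y \<otimes> inv x \<otimes> inv y) [^] n"

lemma H_closed:
  "x \<in> H \<Longrightarrow> x \<in> carrier G" "x \<in> K \<Longrightarrow> x \<in> carrier G" "x \<in> K \<Longrightarrow> x \<in> H"
  "\<lbrakk>x \<in> H; y \<in> H\<rbrakk> \<Longrightarrow> x \<otimes> y \<in> H" "x \<in> H \<Longrightarrow> inv x \<in> H" "\<one> \<in> H"
  "\<lbrakk>x \<in> K; y \<in> K\<rbrakk> \<Longrightarrow> x \<otimes> y \<in> K" "x \<in> K \<Longrightarrow> inv x \<in> K" "\<one> \<in> K"
  using subgroup_H subgroup_K K_le_H subgroup.mem_carrier
  by (auto simp: subgroup.m_closed subgroup.m_inv_closed subgroup.one_closed)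

lemma pow_closed: "x \<in> H \<Longrightarrow> x [^] (i::nat) \<in> H" "x \<in> K \<Longrightarrow> x [^] (i::nat) \<in> K"
  by (induction i) (auto simp: H_closed)

context
  notes H_closed [simp, intro] and pow_closed [simp, intro]
begin

lemma pow_conj: "\<lbrakk>h \<in> H; k \<in> K\<rbrakk> \<Longrightarrow> (h \<otimes> k \<otimes> inv h) [^] n = k [^] n"
  by (simp add: conj_nat_pow pow_commute) (simp add: m_assoc)

lemma B_closed [simp]: "\<lbrakk>x \<in> H; y \<in> H\<rbrakk> \<Longrightarrow> B x y \<in> carrier G"
  by (simp add: B_def)

text \<open>From [xy, z] = (x [y, z] x^-1) [x, z]: both factors lie in \<open>K\<close>, so the
  \<open>n\<close>-th power splits, and \<open>pow_conj\<close> removes the conjugation by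
  \<open>x\<close>.\<close>

lemma B_mult_left:
  assumes "x \<in> H" "y \<in> H" "z \<in> H"
  shows "B (x \<otimes> y) z = B y z \<otimes> B x z"
proof -
  have "x \<otimes> y \<otimes> z \<otimes> inv (x \<otimes> y) \<otimes> inv z =
      (x \<otimes> (y \<otimes> z \<otimes> inv y \<otimes> inv z) \<otimes> inv x) \<otimes> (x \<otimes> z \<otimes> inv x \<otimes> inv z)"
    using assms by (simp add: m_assoc inv_mult_group)
  then show ?thesis
    using assms by (simp only: B_def pow_mult_K pow_conj conj_mem commutator_mem)
qed

text \<open>The mirror identity is [x, yz] = [x, y] (y [x, z] y^-1).\<close>

lemma B_mult_right:
  assumes "x \<in> H" "y \<in> H" "z \<in> H"
  shows "B x (y \<otimes> z) = B x y \<otimes> B x z"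
proof -
  have "x \<otimes> (y \<otimes> z) \<otimes> inv x \<otimes> inv (y \<otimes> z) =
      (x \<otimes> y \<otimes> inv x \<otimes> inv y) \<otimes> (y \<otimes> (x \<otimes> z \<otimes> inv x \<otimes> inv z) \<otimes> inv y)"
    using assms by (simp add: m_assoc inv_mult_group)
  then show ?thesis
    using assms by (simp only: B_def pow_mult_K pow_conj conj_mem commutator_mem)
qed

lemma B_self [simp]: "x \<in> H \<Longrightarrow> B x x = \<one>"
  by (simp add: B_def m_assoc)

lemma B_one [simp]: "x \<in> H \<Longrightarrow> B x \<one> = \<one>" "x \<in> H \<Longrightarrow> B \<one> x = \<one>"
  by (simp_all add: B_def)

text \<open>The commutator [x, k] is the product of x k x^-1 and k^-1, both in \<open>K\<close>, and
  their \<open>n\<close>-th powers cancel. With \<open>B_K_left\<close> this lets \<open>B\<close>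
  descend to \<open>H\<close> modulo \<open>K\<close>.\<close>

lemma B_K_right:
  assumes "x \<in> H" "k \<in> K"
  shows "B x k = \<one>"
  using assms by (simp add: B_def pow_mult_K pow_conj conj_mem nat_pow_inv)

lemma B_K_left:
  assumes "x \<in> H" "k \<in> K"
  shows "B k x = \<one>"
proof -
  have "k \<otimes> x \<otimes> inv k \<otimes> inv x = k \<otimes> (x \<otimes> inv k \<otimes> inv x)"
    using assms by (simp add: m_assoc)
  then show ?thesis
    using assms by (simp add: B_def pow_mult_K pow_conj conj_mem nat_pow_inv)
qed

lemma B_pow_right: "\<lbrakk>x \<in> H; y \<in> H\<rbrakk> \<Longrightarrow> B x (y [^] (i::nat)) = B x y [^] i"
  by (induction i) (simp_all add: B_mult_right)

lemma B_pow_left: "\<lbrakk>x \<in> H; y \<in> H\<rbrakk> \<Longrightarrow> B (x [^] (i::nat)) y = B x y [^] i"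
proof (induction i)
  case (Suc i)
  then show ?case using nat_pow_mult[of "B x y" 1 i] by (simp add: B_mult_left)
qed simp

text \<open>Collecting the factors leaves a correction \<open>w\<close> built from conjugates of the
  commutators [y, x^j] with j < i. Only its \<open>n\<close>-th power matters, and the exponents 0 +
  1 + ... + (i - 1) add up to \<open>i choose 2\<close>.\<close>

lemma pow_product:
  assumes "x \<in> H" "y \<in> H"
  shows "\<exists>w\<in>K. (x \<otimes> y) [^] i = w \<otimes> x [^] i \<otimes> y [^] i \<and> w [^] n = B y x [^] (i choose 2)"
proof (induction i)
  case 0
  show ?case by (rule bexI[of _ \<one>]) (simp_all add: numeral_2_eq_2)
next
  case (Suc i)
  then obtain w where w: "w \<in> K" "(x \<otimes> y) [^] i = w \<otimes> x [^] i \<otimes> y [^] i"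
    "w [^] n = B y x [^] (i choose 2)" by blast
  \<comment> \<open>\<open>?c\<close> is the cost of moving \<open>y\<close> past
    \<open>x [^] i\<close>; \<open>?v\<close> and \<open>?u\<close> are \<open>w\<close> and
    \<open>?c\<close> carried to the far left.\<close>
  let ?c = "y \<otimes> x [^] i \<otimes> inv y \<otimes> inv (x [^] i)"
  let ?v = "(x \<otimes> y) \<otimes> w \<otimes> inv (x \<otimes> y)" and ?u = "x \<otimes> ?c \<otimes> inv x"
  have mem: "?v \<in> K" "?c \<in> K" "?u \<in> K"
    using assms w(1) by (simp_all only: conj_mem commutator_mem H_closed pow_closed)
  have "(x \<otimes> y) [^] Suc i = (x \<otimes> y) \<otimes> (x \<otimes> y) [^] i"
    using assms nat_pow_mult[of "x \<otimes> y" 1 i] nat_pow_mult[of "x \<otimes> y" i 1] by simp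
  also have "\<dots> = ?v \<otimes> ?u \<otimes> (x \<otimes> x [^] i) \<otimes> (y \<otimes> y [^] i)"
    unfolding w(2) using assms w(1) by (simp add: m_assoc inv_mult_group)
  also have "x \<otimes> x [^] i = x [^] Suc i"
    using assms nat_pow_mult[of x 1 i] nat_pow_mult[of x i 1] by simp
  also have "y \<otimes> y [^] i = y [^] Suc i"
    using assms nat_pow_mult[of y 1 i] nat_pow_mult[of y i 1] by simp
  finally have eq: "(x \<otimes> y) [^] Suc i = (?v \<otimes> ?u) \<otimes> x [^] Suc i \<otimes> y [^] Suc i" .
  have "(?v \<otimes> ?u) [^] n = w [^] n \<otimes> B y (x [^] i)"
    using assms w(1) mem
    by (simp only: pow_mult_K pow_conj H_closed commutator_mem pow_closed B_def)
  also have "\<dots> = B y x [^] (Suc i choose 2)"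
    using assms by (simp add: w(3) B_pow_right nat_pow_mult numeral_2_eq_2 add.commute)
  finally show ?case using eq mem by blast
qed

text \<open>The elements \<open>w\<close>, \<open>x [^] q\<close> and \<open>y [^] q\<close> all lie
  in \<open>K\<close>, where the \<open>n\<close>-th power is multiplicative. The only obstruction
  is \<open>w [^] n\<close>, a power of the form \<open>B\<close> that the second hypothesis
  kills.\<close>

lemma pow_mult_H:
  assumes q: "\<And>x. x \<in> H \<Longrightarrow> x [^] q \<in> K"
    and B: "\<And>x y. \<lbrakk>x \<in> H; y \<in> H\<rbrakk> \<Longrightarrow> B y x [^] (q choose 2) = \<one>"
    and xy: "x \<in> H" "y \<in> H"
  shows "(x \<otimes> y) [^] (q * n) = x [^] (q * n) \<otimes> y [^] (q * n)"
proof -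
  obtain w where w: "w \<in> K" "(x \<otimes> y) [^] q = w \<otimes> x [^] q \<otimes> y [^] q" "w [^] n = \<one>"
    using pow_product[OF xy, of q] B xy by auto
  have "(x \<otimes> y) [^] (q * n) = (w \<otimes> x [^] q \<otimes> y [^] q) [^] n"
    using xy by (simp add: w(2) flip: nat_pow_pow)
  also have "\<dots> = w [^] n \<otimes> (x [^] q) [^] n \<otimes> (y [^] q) [^] n"
    using w(1) q xy by (simp add: pow_mult_K)
  finally show ?thesis using w xy by (simp add: nat_pow_pow)
qed

lemma B_pow_exponent:
  assumes "\<And>x. x \<in> H \<Longrightarrow> x [^] (q::nat) \<in> K" "x \<in> H" "y \<in> H"
  shows "B y x [^] (q * i) = \<one>"
  using assms by (simp add: B_K_right flip: nat_pow_pow B_pow_right)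

lemma pow_mult_H_double:
  assumes q: "\<And>x. x \<in> H \<Longrightarrow> x [^] q \<in> K" and xy: "x \<in> H" "y \<in> H"
  shows "(x \<otimes> y) [^] (2 * q * n) = x [^] (2 * q * n) \<otimes> y [^] (2 * q * n)"
proof (rule pow_mult_H)
  show "x [^] (2 * q) \<in> K" if "x \<in> H" for x
    using q[OF that] that by (simp add: mult.commute flip: nat_pow_pow)
  \<comment> \<open>The binomial coefficient is a multiple of \<open>q\<close>, and \<open>B\<close>
    already dies under the \<open>q\<close>-th power.\<close>
  have "(2 * q) choose 2 = q * (2 * q - 1)"
    by (simp add: choose_two)
  then show "B y x [^] ((2 * q) choose 2) = \<one>" if "x \<in> H" "y \<in> H" for x y
    using B_pow_exponent[OF q that] by simp
qed (use xy in auto)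

text \<open>If the form \<open>B\<close> takes a value of full order \<open>2 ^ s\<close> at \<open>(y, x)\<close>, then \<open>x\<close> and \<open>y\<close>
  are independent elements of order \<open>2 ^ s\<close> modulo \<open>K\<close>, since \<open>B\<close> is alternating.\<close>

lemma pow_mult_H_or_independent:
  assumes q: "\<And>x. x \<in> H \<Longrightarrow> x [^] ((2::nat) ^ s) \<in> K"
    and indep: "\<not> (\<exists>x\<in>H. \<exists>y\<in>H. \<forall>i j. x [^] (i::nat) \<otimes> y [^] (j::nat) \<in> K \<longrightarrow>
      2 ^ s dvd i \<and> 2 ^ s dvd j)"
    and xy: "x \<in> H" "y \<in> H"
  shows "(x \<otimes> y) [^] (2 ^ s * n) = x [^] (2 ^ s * n) \<otimes> y [^] (2 ^ s * n)"
proof (rule pow_mult_H[OF q])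
  show "B y x [^] (2 ^ s choose 2) = \<one>" if xy: "x \<in> H" "y \<in> H" for x y
  proof (cases s)
    case 0
    then show ?thesis by (simp add: numeral_2_eq_2)
  next
    case (Suc t)
    \<comment> \<open>This suffices, since \<open>2 ^ s choose 2\<close> is a multiple of
      \<open>2 ^ t\<close>.\<close>
    have "B y x [^] ((2::nat) ^ t) = \<one>"
    proof (rule ccontr)
      assume ne: "B y x [^] ((2::nat) ^ t) \<noteq> \<one>"
      have "ord (B y x) dvd 2 ^ s"
        using B_pow_exponent[OF q xy, of 1] xy by (simp add: pow_eq_id)
      moreover have "\<not> ord (B y x) dvd 2 ^ t"
        using ne xy by (simp add: pow_eq_id)
      ultimately have ord: "ord (B y x) = 2 ^ s"
        by (metis Suc divides_primepow_nat le_Suc_eq le_imp_power_dvd two_is_prime_nat)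
      have "2 ^ s dvd i \<and> 2 ^ s dvd j" if "x [^] (i::nat) \<otimes> y [^] (j::nat) \<in> K" for i j
      proof -
        \<comment> \<open>Pairing with \<open>y\<close> isolates the exponent of \<open>x\<close>,
          and pairing with \<open>x\<close> that of \<open>y\<close>, because \<open>B\<close> is
          alternating; both pairings vanish on \<open>K\<close>.\<close>
        have "B y x [^] i = B y (x [^] i \<otimes> y [^] j)"
          using xy by (simp add: B_mult_right B_pow_right)
        moreover have "B y x [^] j = B (x [^] i \<otimes> y [^] j) x"
          using xy by (simp add: B_mult_left B_pow_left)
        ultimately show ?thesis
          using that xy by (simp add: B_K_left B_K_right pow_eq_id ord)
      qed
      then show False using indep xy by blast
    qed
    moreover have "2 ^ s choose 2 = 2 ^ t * (2 ^ s - 1 :: nat)"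
      using Suc by (simp add: choose_two)
    ultimately show ?thesis
      using xy by (simp flip: nat_pow_pow)
  qed
qed (use xy in auto)

end

end

text \<open>The map taking (i, j) to x^i y^j respects reduction modulo \<open>e\<close> because both
  \<open>e\<close>-th powers are trivial, and \<open>indep\<close> gives its injectivity. The case
  \<open>e = 0\<close> is excluded, as \<open>integer_mod_group 0\<close> is the group of
  integers.\<close>

lemma (in comm_group) independent_imp_square_subgroup:
  assumes xy: "x \<in> carrier G" "y \<in> carrier G" "x [^] e = \<one>" "y [^] e = \<one>" and e: "e > 0"
    and indep: "\<And>i j. x [^] (i::nat) \<otimes> y [^] (j::nat) = \<one> \<Longrightarrow> e dvd i \<and> e dvd j"
  shows "\<exists>H. subgroup H G \<and>
    G\<lparr>carrier := H\<rparr> \<cong> integer_mod_group e \<times>\<times> integer_mod_group e"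
proof -
  let ?Z = "integer_mod_group e"
  let ?h = "\<lambda>(i, j). x [^] (i::int) \<otimes> y [^] (j::int)"
  have red: "z [^] (i mod int e) = z [^] (i::int)" if "z \<in> carrier G" "z [^] e = \<one>" for z i
  proof -
    have "z [^] i = z [^] (int e * (i div int e) + i mod int e)" by simp
    also have "\<dots> = (z [^] (int e)) [^] (i div int e) \<otimes> z [^] (i mod int e)"
      using that by (simp only: int_pow_mult int_pow_pow)
    finally show ?thesis using that by (simp add: int_pow_int)
  qed
  have hom: "?h \<in> hom (?Z \<times>\<times> ?Z) G"
    using xy by (auto intro!: homI simp: red int_pow_mult m_ac)
  have gZ: "group (?Z \<times>\<times> ?Z)" by (simp add: DirProd_group)
  interpret h: group_hom "?Z \<times>\<times> ?Z" G ?h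
    using hom gZ by (simp add: group_hom_def group_hom_axioms_def)
  have "inj_on ?h (carrier (?Z \<times>\<times> ?Z))"
  proof (rule h.inj_on_one_iff[THEN iffD2], safe)
    fix i j assume ij: "(i, j) \<in> carrier (?Z \<times>\<times> ?Z)" "x [^] i \<otimes> y [^] j = \<one>"
    \<comment> \<open>The representatives are nonnegative, so \<open>indep\<close> applies with
      natural exponents, and being below \<open>e\<close> they must be 0.\<close>
    then have b: "0 \<le> i" "i < int e" "0 \<le> j" "j < int e"
      using e by (auto simp: carrier_integer_mod_group)
    then have "x [^] nat i \<otimes> y [^] nat j = \<one>" using ij by (simp flip: int_pow_int)
    from indep[OF this] b show "(i, j) = \<one>\<^bsub>?Z \<times>\<times> ?Z\<^esub>"
      by (auto dest!: dvd_imp_le)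
  qed
  then have "?h \<in> iso (?Z \<times>\<times> ?Z) (G\<lparr>carrier := ?h ` carrier (?Z \<times>\<times> ?Z)\<rparr>)"
    using hom by (auto simp: iso_def hom_def bij_betw_def)
  then have "?Z \<times>\<times> ?Z \<cong> G\<lparr>carrier := ?h ` carrier (?Z \<times>\<times> ?Z)\<rparr>"
    by (auto simp: is_iso_def)
  then show ?thesis
    using h.img_is_subgroup group.iso_sym[OF gZ] by blast
qed

section \<open>Climbing the subnormal series\<close>

lemma (in normal) rcos_eq_subgroup_iff: "x \<in> carrier G \<Longrightarrow> H #> x = H \<longleftrightarrow> x \<in> H"
  using coset_join1 coset_join2 is_subgroup by blast

lemma (in normal) group_exponent_Mod_dvd_iff:
  "group_exponent (G Mod H) dvd n \<longleftrightarrow> (\<forall>x\<in>carrier G. x [^] n \<in> H)"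
  by (simp add: group.group_exponent_dvd_iff[OF factorgroup_is_group] carrier_FactGroup
      FactGroup_pow rcos_eq_subgroup_iff)

lemma (in normal) commutator_mem_if_comm_Mod:
  assumes "comm_group (G Mod H)" "x \<in> carrier G" "y \<in> carrier G"
  shows "x \<otimes> y \<otimes> inv x \<otimes> inv y \<in> H"
proof -
  have c: "H #> x \<in> carrier (G Mod H)" "H #> y \<in> carrier (G Mod H)"
    using assms by (auto simp: carrier_FactGroup)
  have "H #> (x \<otimes> y) = (H #> x) \<otimes>\<^bsub>G Mod H\<^esub> (H #> y)"
    using assms by (simp add: rcos_sum)
  also have "\<dots> = (H #> y) \<otimes>\<^bsub>G Mod H\<^esub> (H #> x)"
    using comm_groupE(4)[OF assms(1) c] .
  also have "\<dots> = H #> (y \<otimes> x)"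
    using assms by (simp add: rcos_sum)
  finally have "x \<otimes> y \<in> H #> (y \<otimes> x)"
    using assms rcos_self[OF _ is_subgroup, of "x \<otimes> y"] by simp
  then obtain h where h: "h \<in> H" "x \<otimes> y = h \<otimes> (y \<otimes> x)"
    by (auto simp: r_coset_def)
  then have "x \<otimes> y \<otimes> inv x \<otimes> inv y = h"
    using assms mem_carrier[OF h(1)] by (simp add: m_assoc)
  then show ?thesis using h by simp
qed

lemma (in normal) independent_imp_square_subgroup_Mod:
  assumes "comm_group (G Mod H)" "x \<in> carrier G" "y \<in> carrier G"
    and "x [^] e \<in> H" "y [^] e \<in> H" "e > 0"
    and "\<And>i j. x [^] (i::nat) \<otimes> y [^] (j::nat) \<in> H \<Longrightarrow> e dvd i \<and> e dvd j"
  shows "\<exists>K. subgroup K (G Mod H) \<and>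
    (G Mod H)\<lparr>carrier := K\<rparr> \<cong> integer_mod_group e \<times>\<times> integer_mod_group e"
proof (rule comm_group.independent_imp_square_subgroup[OF assms(1), of "H #> x" "H #> y"])
  fix i j :: nat
  assume "(H #> x) [^]\<^bsub>G Mod H\<^esub> i \<otimes>\<^bsub>G Mod H\<^esub> (H #> y) [^]\<^bsub>G Mod H\<^esub> j = \<one>\<^bsub>G Mod H\<^esub>"
  then show "e dvd i \<and> e dvd j"
    using assms by (simp add: FactGroup_pow rcos_sum rcos_eq_subgroup_iff)
qed (use assms in \<open>auto simp: carrier_FactGroup FactGroup_pow rcos_eq_subgroup_iff\<close>)

section \<open>One step up the series, and the induction\<close>

lemma (in group_hom) subgroup_vimage:
  assumes "subgroup K H"
  shows "subgroup {x \<in> carrier G. h x \<in> K} G"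
  using subgroup.m_closed[OF assms] subgroup.one_closed[OF assms] subgroup.m_inv_closed[OF assms]
  by (intro G.subgroupI) auto

text \<open>Verbatim the condition that puts an index into \<open>I\<close>, so the two can be
  exchanged by unfolding.\<close>

definition has_exponent_square :: "('a, 'b) monoid_scheme \<Rightarrow> bool" where
  "has_exponent_square Q \<longleftrightarrow> (\<exists>H. subgroup H Q \<and>
     Q\<lparr>carrier := H\<rparr> \<cong> integer_mod_group (group_exponent Q) \<times>\<times> integer_mod_group (group_exponent Q))"

text \<open>Here \<open>h\<close> plays the projection of a central extension. The conclusions are
  \<open>IH1\<close> and \<open>IH2\<close> with \<open>L\<close> in place of \<open>N\<close> and
  \<open>q * n\<close> in place of \<open>n\<close>, so the step can be iterated; normality of
  \<open>N\<close> is asked in \<open>L\<close> only.\<close>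

lemma (in group_hom) central_power_map_step:
  fixes n :: nat
  assumes central: "\<And>z x. \<lbrakk>z \<in> carrier G; h z = \<one>\<^bsub>H\<^esub>; x \<in> carrier G\<rbrakk> \<Longrightarrow> x \<otimes> z = z \<otimes> x"
    and L: "subgroup L H" and N: "N \<lhd> H\<lparr>carrier := L\<rparr>"
    and comm: "comm_group ((H\<lparr>carrier := L\<rparr>) Mod N)"
    and e: "group_exponent ((H\<lparr>carrier := L\<rparr>) Mod N) = 2 ^ s"
    and IH1: "\<And>x. \<lbrakk>x \<in> carrier G; h x \<in> N\<rbrakk> \<Longrightarrow> h (x [^] n) = \<one>\<^bsub>H\<^esub>"
    and IH2: "\<And>x y. \<lbrakk>x \<in> carrier G; y \<in> carrier G; h x \<in> N; h y \<in> N\<rbrakk>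
      \<Longrightarrow> (x \<otimes> y) [^] n = x [^] n \<otimes> y [^] n"
    and q: "q = (if has_exponent_square ((H\<lparr>carrier := L\<rparr>) Mod N) then 2 else 1) * 2 ^ s"
    and x: "x \<in> carrier G" "h x \<in> L"
  shows "h (x [^] (q * n)) = \<one>\<^bsub>H\<^esub>"
    and "\<lbrakk>y \<in> carrier G; h y \<in> L\<rbrakk> \<Longrightarrow> (x \<otimes> y) [^] (q * n) = x [^] (q * n) \<otimes> y [^] (q * n)"
proof -
  let ?Q = "(H\<lparr>carrier := L\<rparr>) Mod N"
  define L' where "L' = {x \<in> carrier G. h x \<in> L}"
  define N' where "N' = {x \<in> carrier G. h x \<in> N}"
  have mem: "a \<in> L' \<longleftrightarrow> a \<in> carrier G \<and> h a \<in> L" "a \<in> N' \<longleftrightarrow> a \<in> carrier G \<and> h a \<in> N" for a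
    by (simp_all add: L'_def N'_def)
  interpret N: normal N "H\<lparr>carrier := L\<rparr>" by (rule N)
  have NL: "N \<subseteq> L" using N.subset by simp
  have sN: "subgroup N H" by (rule H.incl_subgroup[OF L N.is_subgroup])
  have invL: "inv\<^bsub>H\<lparr>carrier := L\<rparr>\<^esub> a = inv\<^bsub>H\<^esub> a" if "a \<in> L" for a
    using that L by simp
  \<comment> \<open>Normality of \<open>N\<close> gives the conjugation axiom and
    \<open>comm\<close> the commutator axiom. By \<open>IH1\<close> the \<open>n\<close>-th powers
    from \<open>N'\<close> lie in the kernel of \<open>h\<close>, which is central.\<close>
  interpret P: central_power_map G L' N' n
  proof (intro central_power_map.intro central_power_map_axioms.intro G.group_axioms)
    show "subgroup L' G" "subgroup N' G" using subgroup_vimage L sN by (auto simp: L'_def N'_def)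
    show "N' \<subseteq> L'" using NL by (auto simp: mem)
    fix a k assume ak: "a \<in> L'" "k \<in> N'"
    show "a \<otimes> k \<otimes> inv a \<in> N'"
      using ak N.inv_op_closed2[of "h a" "h k"] by (simp add: invL mem)
    show "a \<otimes> k [^] n = k [^] n \<otimes> a"
      using ak by (intro central) (auto simp: mem intro: IH1)
  next
    fix a b assume ab: "a \<in> L'" "b \<in> L'"
    then show "a \<otimes> b \<otimes> inv a \<otimes> inv b \<in> N'"
      using N.commutator_mem_if_comm_Mod[OF comm, of "h a" "h b"] by (simp add: invL mem)
  next
    fix a b assume "a \<in> N'" "b \<in> N'"
    then show "(a \<otimes> b) [^] n = a [^] n \<otimes> b [^] n" using IH2 by (simp add: mem)
  qed
  have pow: "h a [^]\<^bsub>H\<lparr>carrier := L\<rparr>\<^esub> i = h (a [^] i)" if "a \<in> carrier G" for a and i :: nat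
    using hom_nat_pow[OF that] H.nat_pow_consistent[of "h a" i L] by metis
  have powN: "a [^] i \<in> N'" if "a \<in> L'" "2 ^ s dvd i" for a and i :: nat
    using N.group_exponent_Mod_dvd_iff[of i] that by (auto simp: e pow mem)
  have "2 ^ s dvd q" by (simp add: q)
  then show "h (x [^] (q * n)) = \<one>\<^bsub>H\<^esub>"
    using powN[of x q] x IH1 by (simp add: mem flip: G.nat_pow_pow)
  assume y: "y \<in> carrier G" "h y \<in> L"
  show "(x \<otimes> y) [^] (q * n) = x [^] (q * n) \<otimes> y [^] (q * n)"
  proof (cases "has_exponent_square ?Q")
    case True
    then show ?thesis
      using P.pow_mult_H_double[of "2 ^ s" x y] powN x y by (simp add: q mem)
  next
    case False
    \<comment> \<open>Such a pair would map under \<open>h\<close> to independent elements of order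
      \<open>2 ^ s\<close> in the quotient, generating the square that this case excludes.\<close>
    have "\<not> (\<exists>x\<in>L'. \<exists>y\<in>L'. \<forall>i j. x [^] (i::nat) \<otimes> y [^] (j::nat) \<in> N' \<longrightarrow>
      2 ^ s dvd i \<and> 2 ^ s dvd j)"
    proof safe
      fix a b
      assume ab: "a \<in> L'" "b \<in> L'"
        and "\<forall>i j. a [^] (i::nat) \<otimes> b [^] (j::nat) \<in> N' \<longrightarrow> 2 ^ s dvd i \<and> 2 ^ s dvd j"
      then have "has_exponent_square ?Q"
        unfolding has_exponent_square_def e
        using powN[of a "2 ^ s"] powN[of b "2 ^ s"]
        by (intro N.independent_imp_square_subgroup_Mod[OF comm, of "h a" "h b"])
           (auto simp: pow mem)
      then show False using False by simp
    qed
    from P.pow_mult_H_or_independent[OF _ this, of x y] show ?thesis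
      using powN x y False by (simp add: q mem)
  qed
qed

text \<open>Induction downwards in the index: at \<open>r\<close> the preimage is the kernel and the
  exponent is the empty product 1.\<close>

lemma (in group_hom) subnormal_central_power_map:
  assumes central: "\<And>z x. \<lbrakk>z \<in> carrier G; h z = \<one>\<^bsub>H\<^esub>; x \<in> carrier G\<rbrakk> \<Longrightarrow> x \<otimes> z = z \<otimes> x"
    and ord: "\<And>g. g \<in> carrier H \<Longrightarrow> g [^]\<^bsub>H\<^esub> ((2::nat) ^ m) = \<one>\<^bsub>H\<^esub>"
    and sub: "\<And>i. i \<le> r \<Longrightarrow> subgroup (N i) H" and Nr: "N r = {\<one>\<^bsub>H\<^esub>}" and r: "r \<ge> 1"
    and norm: "\<And>i. i \<in> {1..r} \<Longrightarrow> N i \<lhd> H\<lparr>carrier := N (i - 1)\<rparr>"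
    and comm: "\<And>i. i \<in> {1..r} \<Longrightarrow> comm_group (series_factor H N i)"
    and n: "n = (\<Prod>j=2..r. (if has_exponent_square (series_factor H N j) then 2 else 1) *
                 group_exponent (series_factor H N j))"
  shows "\<forall>x\<in>carrier G. h x \<in> N 1 \<longrightarrow> h (x [^] n) = \<one>\<^bsub>H\<^esub> \<and>
    (\<forall>y\<in>carrier G. h y \<in> N 1 \<longrightarrow> (x \<otimes> y) [^] n = x [^] n \<otimes> y [^] n)"
proof -
  define f where "f j = (if has_exponent_square (series_factor H N j) then 2 else 1) *
    group_exponent (series_factor H N j)" for j
  \<comment> \<open>The product runs over the factors of the series inside \<open>N i\<close>; at
    \<open>i = 1\<close> these are the indices 2 to \<open>r\<close>.\<close>
  define P where "P i \<longleftrightarrow> (\<forall>x\<in>carrier G. h x \<in> N i \<longrightarrow> h (x [^] prod f {Suc i..r}) = \<one>\<^bsub>H\<^esub> \<and>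
    (\<forall>y\<in>carrier G. h y \<in> N i \<longrightarrow> (x \<otimes> y) [^] prod f {Suc i..r} =
      x [^] prod f {Suc i..r} \<otimes> y [^] prod f {Suc i..r}))" for i
  have "P 1"
  proof (rule inc_induct[OF r])
    show "P r" by (simp add: P_def Nr)
  next
    fix i assume i: "1 \<le> i" "i < r" "P (Suc i)"
    let ?L = "H\<lparr>carrier := N i\<rparr>"
    have Q: "series_factor H N (Suc i) = ?L Mod N (Suc i)" by (simp add: series_factor_def)
    have norm': "N (Suc i) \<lhd> ?L" using norm[of "Suc i"] i by simp
    have sub': "subgroup (N i) H" using sub i by simp
    \<comment> \<open>The common bound \<open>2 ^ m\<close> makes the exponent of each factor a
      power of 2, as the step requires.\<close>
    have "group_exponent (?L Mod N (Suc i)) dvd 2 ^ m"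
      using ord subgroup.mem_carrier[OF sub'] subgroup.one_closed[OF normal_imp_subgroup[OF norm']]
      by (simp add: normal.group_exponent_Mod_dvd_iff[OF norm'] flip: H.nat_pow_consistent)
    then obtain s where s: "group_exponent (?L Mod N (Suc i)) = 2 ^ s"
      by (auto simp: divides_primepow_nat)
    have "{Suc i..r} = insert (Suc i) {Suc (Suc i)..r}" using i by auto
    then have "prod f {Suc i..r} = f (Suc i) * prod f {Suc (Suc i)..r}" by simp
    moreover note step = central_power_map_step[OF central sub' norm' _ s, of "prod f {Suc (Suc i)..r}" "f (Suc i)"]
    ultimately show "P i"
      using i(3) comm[of "Suc i"] i(1,2) unfolding P_def
      by (auto simp: f_def s Q intro!: step)
  qed
  then show ?thesis by (simp add: P_def f_def n numeral_2_eq_2)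
qed

section \<open>Cocycles and their extensions\<close>

lemma cochain_pow:
  assumes "f \<in> cocycles2 G"
  shows "f [^]\<^bsub>(cochains2 G)\<lparr>carrier := cocycles2 G\<rparr>\<^esub> (n::nat) =
    (\<lambda>p\<in>carrier G \<times> carrier G. f p ^ n)"
  by (induction n) (auto simp: fun_eq_iff)

lemma (in group) group_exponent_schur_multiplier_dvd_iff:
  "group_exponent (schur_multiplier G) dvd n \<longleftrightarrow>
    (\<forall>f\<in>cocycles2 G. (\<lambda>p\<in>carrier G \<times> carrier G. f p ^ n) \<in> coboundaries2 G)"
proof -
  let ?Z = "(cochains2 G)\<lparr>carrier := cocycles2 G\<rparr>"
  have "comm_group ?Z"
    by (rule group.group_comm_groupI
          [OF subgroup.subgroup_is_group[OF subgroup_cocycles2 group_cochains2]])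
       (simp add: mult.commute)
  then have "coboundaries2 G \<lhd> ?Z"
    using subgroup_coboundaries2 comm_group.normal_iff_subgroup by blast
  from normal.group_exponent_Mod_dvd_iff[OF this, of n] show ?thesis
    by (simp add: schur_multiplier_def cochain_pow)
qed

text \<open>The witness \<open>c\<close> may take any values off the group, so it can be given by a
  plain formula.\<close>

lemma (in group) coboundaries2_iff:
  "b \<in> coboundaries2 G \<longleftrightarrow> b \<in> extensional (carrier G \<times> carrier G) \<and>
    (\<exists>c. (\<forall>x\<in>carrier G. c x \<noteq> 0) \<and>
      (\<forall>x\<in>carrier G. \<forall>y\<in>carrier G. b (x, y) = c x * c y / c (x \<otimes> y)))" (is "_ \<longleftrightarrow> ?R")
proof
  assume "b \<in> coboundaries2 G"
  then obtain c where c: "c \<in> carrier (product_group (carrier G) (\<lambda>_. complex_units))"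
    "b = coboundary1 G c"
    by (auto simp: coboundaries2_def)
  then have "\<forall>x\<in>carrier G. c x \<noteq> 0" by (auto simp: complex_units_def)
  moreover have "\<forall>x\<in>carrier G. \<forall>y\<in>carrier G. b (x, y) = c x * c y / c (x \<otimes> y)"
    and "b \<in> extensional (carrier G \<times> carrier G)"
    by (simp_all add: c(2) coboundary1_def)
  ultimately show ?R by blast
next
  assume ?R
  then obtain c where c: "b \<in> extensional (carrier G \<times> carrier G)" "\<And>x. x \<in> carrier G \<Longrightarrow> c x \<noteq> 0"
    "\<And>x y. \<lbrakk>x \<in> carrier G; y \<in> carrier G\<rbrakk> \<Longrightarrow> b (x, y) = c x * c y / c (x \<otimes> y)"
    by blast
  have "b = coboundary1 G (restrict c (carrier G))"
    by (rule extensionalityI[OF c(1)]) (auto simp: coboundary1_def c(3))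
  moreover have "restrict c (carrier G) \<in> carrier (product_group (carrier G) (\<lambda>_. complex_units))"
    using c(2) by (auto simp: complex_units_def)
  ultimately show "b \<in> coboundaries2 G"
    by (auto simp: coboundaries2_def)
qed

section \<open>Cocycles and their central extensions\<close>

lemma cocycles2_iff:
  "f \<in> cocycles2 G \<longleftrightarrow> f \<in> extensional (carrier G \<times> carrier G) \<and>
    (\<forall>x\<in>carrier G. \<forall>y\<in>carrier G. f (x, y) \<noteq> 0) \<and>
    (\<forall>x\<in>carrier G. \<forall>y\<in>carrier G. \<forall>z\<in>carrier G.
       f (y, z) * f (x, y \<otimes>\<^bsub>G\<^esub> z) = f (x \<otimes>\<^bsub>G\<^esub> y, z) * f (x, y))"
  by (auto simp: cocycles2_def cochains2_def complex_units_def PiE_iff)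

text \<open>The cocycle is not normalised, which accounts for the scalar in the unit; accordingly a
  scalar \<open>a\<close> is embedded as \<open>(a / f (\<one>, \<one>), \<one>)\<close>.\<close>

definition cocycle_extension ::
  "('a, 'b) monoid_scheme \<Rightarrow> ('a \<times> 'a \<Rightarrow> complex) \<Rightarrow> (complex \<times> 'a) monoid" where
  "cocycle_extension G f =
     \<lparr>carrier = (- {0}) \<times> carrier G,
      monoid.mult = (\<lambda>(a, g) (b, h). (a * b * f (g, h), g \<otimes>\<^bsub>G\<^esub> h)),
      one = (inverse (f (\<one>\<^bsub>G\<^esub>, \<one>\<^bsub>G\<^esub>)), \<one>\<^bsub>G\<^esub>)\<rparr>"

locale two_cocycle = group +
  fixes f
  assumes cocycle: "f \<in> cocycles2 G"
begin

abbreviation E where "E \<equiv> cocycle_extension G f"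

lemma f_nonzero [simp]: "\<lbrakk>x \<in> carrier G; y \<in> carrier G\<rbrakk> \<Longrightarrow> f (x, y) \<noteq> 0"
  using cocycle by (simp add: cocycles2_iff)

lemma f_cocycle:
  "\<lbrakk>x \<in> carrier G; y \<in> carrier G; z \<in> carrier G\<rbrakk> \<Longrightarrow>
    f (y, z) * f (x, y \<otimes> z) = f (x \<otimes> y, z) * f (x, y)"
  using cocycle by (simp add: cocycles2_iff)

lemma f_one:
  assumes "x \<in> carrier G"
  shows "f (\<one>, x) = f (\<one>, \<one>)" "f (x, \<one>) = f (\<one>, \<one>)"
  using f_cocycle[of \<one> \<one> x] f_cocycle[of x \<one> \<one>] assms by simp_all

lemma carrier_E [simp]: "carrier E = (- {0}) \<times> carrier G"
  and mult_E [simp]: "(a, g) \<otimes>\<^bsub>E\<^esub> (b, h) = (a * b * f (g, h), g \<otimes> h)"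
  and one_E [simp]: "\<one>\<^bsub>E\<^esub> = (inverse (f (\<one>, \<one>)), \<one>)"
  by (simp_all add: cocycle_extension_def)

lemma group_E: "group E"
proof (rule groupI)
  fix x y z assume "x \<in> carrier E" "y \<in> carrier E" "z \<in> carrier E"
  moreover obtain a b c g h k where "x = (a, g)" "y = (b, h)" "z = (c, k)"
    by (cases x; cases y; cases z)
  ultimately show "x \<otimes>\<^bsub>E\<^esub> y \<otimes>\<^bsub>E\<^esub> z = x \<otimes>\<^bsub>E\<^esub> (y \<otimes>\<^bsub>E\<^esub> z)"
    using f_cocycle[of g h k] by (simp add: m_assoc mult_ac)
next
  fix x assume "x \<in> carrier E"
  then obtain a g where "x = (a, g)" "a \<noteq> 0" "g \<in> carrier G" by auto
  then show "\<exists>y\<in>carrier E. y \<otimes>\<^bsub>E\<^esub> x = \<one>\<^bsub>E\<^esub>"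
    \<comment> \<open>The scalar is solved from a' * a * f (inv g, g) = 1 / f (1, 1).\<close>
    by (intro bexI[of _ "(inverse (a * f (inv g, g) * f (\<one>, \<one>)), inv g)"]) (simp_all add: field_simps)
next
  fix x assume "x \<in> carrier E"
  then show "\<one>\<^bsub>E\<^esub> \<otimes>\<^bsub>E\<^esub> x = x"
    using f_one(1)[of "snd x"] by auto
qed auto

lemma group_hom_snd: "group_hom E G snd"
  using group_E is_group by (auto simp: group_hom_def group_hom_axioms_def intro!: homI)

lemma kernel_central:
  assumes "z \<in> carrier E" "snd z = \<one>" "x \<in> carrier E"
  shows "x \<otimes>\<^bsub>E\<^esub> z = z \<otimes>\<^bsub>E\<^esub> x"
  using assms f_one[of "snd x"] by (auto simp: mult_ac)

lemma scalar_pow: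
  assumes "a \<noteq> 0"
  shows "(a / f (\<one>, \<one>), \<one>) [^]\<^bsub>E\<^esub> (n::nat) = (a ^ n / f (\<one>, \<one>), \<one>)"
proof -
  interpret E: group E by (rule group_E)
  show ?thesis by (induction n) (simp_all add: inverse_eq_divide)
qed

text \<open>On the preimage \<open>M\<close> of \<open>S\<close> the power map is a
  conjugation-invariant homomorphism \<phi> to the scalars that is a -> a^n on scalars. It therefore
  splits the preimage of \<open>S\<close> in the extension given by \<open>f ^ n\<close> by a normal
  subgroup, and dividing by that subgroup leaves an extension of \<open>G Mod S\<close>, with
  cocycle \<beta>.\<close>

lemma cocycle_pow_inflated:
  assumes S: "S \<lhd> G"
    and pow_snd: "\<And>x. \<lbrakk>x \<in> carrier E; snd x \<in> S\<rbrakk> \<Longrightarrow> snd (x [^]\<^bsub>E\<^esub> n) = \<one>"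
    and pow_mult: "\<And>x y. \<lbrakk>x \<in> carrier E; y \<in> carrier E; snd x \<in> S; snd y \<in> S\<rbrakk> \<Longrightarrow>
      (x \<otimes>\<^bsub>E\<^esub> y) [^]\<^bsub>E\<^esub> (n::nat) = x [^]\<^bsub>E\<^esub> n \<otimes>\<^bsub>E\<^esub> y [^]\<^bsub>E\<^esub> n"
  obtains c \<beta> where "\<And>g. g \<in> carrier G \<Longrightarrow> c g \<noteq> 0" "\<beta> \<in> cocycles2 (G Mod S)"
    "\<And>g h. \<lbrakk>g \<in> carrier G; h \<in> carrier G\<rbrakk> \<Longrightarrow>
      f (g, h) ^ n = \<beta> (S #> g, S #> h) * (c g * c h / c (g \<otimes> h))"
proof -
  interpret S: normal S G by (rule S)
  interpret E: group E by (rule group_E)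
  interpret p: group_hom E G snd by (rule group_hom_snd)
  define M where "M = {x \<in> carrier E. snd x \<in> S}"
  have M: "subgroup M E" unfolding M_def by (rule p.subgroup_vimage[OF S.is_subgroup])
  have M_carrier: "x \<in> carrier E" if "x \<in> M" for x using that by (simp add: M_def)
  have M_conj: "x \<otimes>\<^bsub>E\<^esub> y \<otimes>\<^bsub>E\<^esub> inv\<^bsub>E\<^esub> x \<in> M" if "x \<in> carrier E" "y \<in> M" for x y
    using that S.inv_op_closed2[of "snd x" "snd y"] unfolding M_def
    by (simp del: carrier_E)
  \<comment> \<open>The factor \<open>f (\<one>, \<one>)\<close> undoes the offset in the embedding
    of the scalars.\<close>
  define \<phi> where "\<phi> x = fst (x [^]\<^bsub>E\<^esub> n) * f (\<one>, \<one>)" for x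
  have \<phi>_mult: "\<phi> (x \<otimes>\<^bsub>E\<^esub> y) = \<phi> x * \<phi> y" if "x \<in> M" "y \<in> M" for x y
    using that pow_snd[of x] pow_snd[of y] pow_mult[of x y]
    by (cases "x [^]\<^bsub>E\<^esub> n"; cases "y [^]\<^bsub>E\<^esub> n") (auto simp: \<phi>_def M_def)
  have \<phi>_nz: "\<phi> x \<noteq> 0" if "x \<in> carrier E" for x
    using E.nat_pow_closed[OF that, of n] by (auto simp: \<phi>_def)
  have \<phi>_conj: "\<phi> (x \<otimes>\<^bsub>E\<^esub> y \<otimes>\<^bsub>E\<^esub> inv\<^bsub>E\<^esub> x) = \<phi> y" if "x \<in> carrier E" "y \<in> M" for x y
  proof -
    have y: "y \<in> carrier E" using that by (simp add: M_def)
    have "x \<otimes>\<^bsub>E\<^esub> y [^]\<^bsub>E\<^esub> n = y [^]\<^bsub>E\<^esub> n \<otimes>\<^bsub>E\<^esub> x"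
      using that y pow_snd[of y]
      by (intro kernel_central E.nat_pow_closed) (simp_all add: M_def del: carrier_E)
    then have "(x \<otimes>\<^bsub>E\<^esub> y \<otimes>\<^bsub>E\<^esub> inv\<^bsub>E\<^esub> x) [^]\<^bsub>E\<^esub> n = y [^]\<^bsub>E\<^esub> n"
      using that(1) y E.conj_nat_pow[of y x n] E.m_assoc[of "y [^]\<^bsub>E\<^esub> n" x "inv\<^bsub>E\<^esub> x"]
      by (simp del: carrier_E mult_E one_E)
    then show ?thesis by (simp add: \<phi>_def)
  qed
  have \<phi>_scalar: "\<phi> (a / f (\<one>, \<one>), \<one>) = a ^ n" if "a \<noteq> 0" for a
    using that by (simp add: \<phi>_def scalar_pow)
  \<comment> \<open>\<open>u\<close> is a section of \<open>snd\<close> over all of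
    \<open>G\<close>; \<open>t\<close> fixes a single lift for each coset of
    \<open>S\<close>.\<close>
  define u where "u g = (1 :: complex, g)" for g :: 'a
  define t where "t q = u (SOME g. g \<in> q)" for q
  have u_closed: "u g \<in> carrier E" and snd_u: "snd (u g) = g" if "g \<in> carrier G" for g
    using that by (auto simp: u_def)
  have u_mult: "u g \<otimes>\<^bsub>E\<^esub> u h = (f (g, h) / f (\<one>, \<one>), \<one>) \<otimes>\<^bsub>E\<^esub> u (g \<otimes> h)"
    if "g \<in> carrier G" "h \<in> carrier G" for g h
    using that by (simp add: u_def f_one(1)[of "g \<otimes> h"])
  note carrier_E [simp del] mult_E [simp del] one_E [simp del]
  have rep: "(SOME x. x \<in> S #> g) \<in> S #> g" if "g \<in> carrier G" for g
    using rcos_self[OF that S.is_subgroup] by (rule someI)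
  have rep_closed: "(SOME x. x \<in> S #> g) \<in> carrier G" if "g \<in> carrier G" for g
    using rep[OF that] r_coset_subset_G[OF S.subset that] by blast
  have t_closed: "t (S #> g) \<in> carrier E" if "g \<in> carrier G" for g
    using u_closed rep_closed that by (simp add: t_def)
  have coset_t: "S #> snd (t (S #> g)) = S #> g" if "g \<in> carrier G" for g
    using rep[OF that] repr_independence[OF _ that S.is_subgroup, of "SOME x. x \<in> S #> g"]
    by (simp add: t_def snd_u rep_closed that)
  have mem_M: "x \<in> M" if "x \<in> carrier E" "S #> snd x = S" for x
    using that S.rcos_eq_subgroup_iff[of "snd x"] by (auto simp: M_def)
  have coset_snd_mult: "S #> snd (x \<otimes>\<^bsub>E\<^esub> y) = (S #> snd x) \<otimes>\<^bsub>G Mod S\<^esub> (S #> snd y)"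
    if "x \<in> carrier E" "y \<in> carrier E" for x y
    using that S.rcos_sum[of "snd x" "snd y"] by auto
  have coset_closed: "S #> g \<in> carrier (G Mod S)" if "g \<in> carrier G" for g
    using that by (auto simp: carrier_FactGroup)
  have coset_mult: "S #> (g \<otimes> h) = (S #> g) \<otimes>\<^bsub>G Mod S\<^esub> (S #> h)"
    if "g \<in> carrier G" "h \<in> carrier G" for g h
    using that by (simp add: S.rcos_sum)
  have M_if_coset_eq: "inv\<^bsub>E\<^esub> x \<otimes>\<^bsub>E\<^esub> y \<in> M" "y \<otimes>\<^bsub>E\<^esub> inv\<^bsub>E\<^esub> x \<in> M"
    if "x \<in> carrier E" "y \<in> carrier E" "S #> snd x = S #> snd y" for x y
  proof -
    have xy: "snd x \<in> carrier G" "snd y \<in> carrier G" using that by auto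
    have "S #> snd (inv\<^bsub>E\<^esub> x \<otimes>\<^bsub>E\<^esub> y) = (S #> inv (snd x)) \<otimes>\<^bsub>G Mod S\<^esub> (S #> snd x)"
      using that by (simp only: coset_snd_mult E.inv_closed p.hom_inv)
    also have "\<dots> = S" using xy by (simp add: S.rcos_sum S.rcos_eq_subgroup_iff)
    finally show "inv\<^bsub>E\<^esub> x \<otimes>\<^bsub>E\<^esub> y \<in> M"
      using that by (intro mem_M E.m_closed E.inv_closed)
    have "S #> snd (y \<otimes>\<^bsub>E\<^esub> inv\<^bsub>E\<^esub> x) = (S #> snd x) \<otimes>\<^bsub>G Mod S\<^esub> (S #> inv (snd x))"
      using that by (simp only: coset_snd_mult E.inv_closed p.hom_inv)
    also have "\<dots> = S" using xy by (simp add: S.rcos_sum S.rcos_eq_subgroup_iff)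
    finally show "y \<otimes>\<^bsub>E\<^esub> inv\<^bsub>E\<^esub> x \<in> M"
      using that by (intro mem_M E.m_closed E.inv_closed)
  qed
  \<comment> \<open>Each \<open>u g\<close> is the lift of its coset times \<open>k g\<close> in
    \<open>M\<close>. Applying \<phi> to \<open>k\<close> gives the cochain \<open>c\<close>, and
    applying it to the factor set of \<open>t\<close> gives \<beta>.\<close>
  define k where "k g = inv\<^bsub>E\<^esub> t (S #> g) \<otimes>\<^bsub>E\<^esub> u g" for g
  have k_M: "k g \<in> M" if "g \<in> carrier G" for g
    unfolding k_def using that by (intro M_if_coset_eq t_closed u_closed) (simp_all add: coset_t snd_u)
  have u_eq: "u g = t (S #> g) \<otimes>\<^bsub>E\<^esub> k g" if "g \<in> carrier G" for g
    unfolding k_def using that t_closed u_closed by simp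
  define c where "c g = \<phi> (k g)" for g
  define \<beta> where "\<beta> = (\<lambda>(q, r)\<in>carrier (G Mod S) \<times> carrier (G Mod S).
    \<phi> (t q \<otimes>\<^bsub>E\<^esub> t r \<otimes>\<^bsub>E\<^esub> inv\<^bsub>E\<^esub> t (q \<otimes>\<^bsub>G Mod S\<^esub> r)))"
  have c_nz: "c g \<noteq> 0" if "g \<in> carrier G" for g
    unfolding c_def using k_M[OF that] by (intro \<phi>_nz M_carrier)
  have main: "f (g, h) ^ n * c (g \<otimes> h) = \<beta> (S #> g, S #> h) * (c g * c h)"
    if g: "g \<in> carrier G" and h: "h \<in> carrier G" for g h
  proof -
    let ?t = "\<lambda>g. t (S #> g)"
    let ?z = "(f (g, h) / f (\<one>, \<one>), \<one>)"
    let ?b = "?t g \<otimes>\<^bsub>E\<^esub> ?t h \<otimes>\<^bsub>E\<^esub> inv\<^bsub>E\<^esub> ?t (g \<otimes> h)"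
    \<comment> \<open>\<open>?w\<close> is \<open>k g\<close> after being moved to the right of the
      lift of \<open>h\<close>.\<close>
    let ?w = "inv\<^bsub>E\<^esub> ?t h \<otimes>\<^bsub>E\<^esub> k g \<otimes>\<^bsub>E\<^esub> inv\<^bsub>E\<^esub> (inv\<^bsub>E\<^esub> ?t h)"
    note cl = t_closed[OF g] t_closed[OF h] t_closed[OF m_closed[OF g h]]
    note kc = k_M[OF g] k_M[OF h] k_M[OF m_closed[OF g h]]
    note kE = kc[THEN M_carrier]
    have z: "?z \<in> M" using g h S.one_closed by (simp add: M_def carrier_E)
    have w: "?w \<in> M" by (intro M_conj E.inv_closed cl kc)
    have b: "?b \<in> M"
    proof (rule M_if_coset_eq(2))
      have "S #> snd (?t (g \<otimes> h)) = (S #> g) \<otimes>\<^bsub>G Mod S\<^esub> (S #> h)"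
        using coset_t[OF m_closed[OF g h]] coset_mult[OF g h] by (rule trans)
      also have "\<dots> = S #> snd (?t g \<otimes>\<^bsub>E\<^esub> ?t h)"
        using coset_snd_mult[OF cl(1,2)] unfolding coset_t[OF g] coset_t[OF h] by (rule sym)
      finally show "S #> snd (?t (g \<otimes> h)) = S #> snd (?t g \<otimes>\<^bsub>E\<^esub> ?t h)" .
    qed (intro E.m_closed cl)+
    \<comment> \<open>Dividing the relation for \<open>u g\<close>, \<open>u h\<close> and
      \<open>u (g \<otimes> h)\<close> by the lift of \<open>g \<otimes> h\<close> on the right
      turns both sides into products of elements of \<open>M\<close>, to which \<phi>
      applies.\<close>
    let ?v = "?t (g \<otimes> h) \<otimes>\<^bsub>E\<^esub> (?w \<otimes>\<^bsub>E\<^esub> k h) \<otimes>\<^bsub>E\<^esub> inv\<^bsub>E\<^esub> ?t (g \<otimes> h)"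
    let ?v' = "?t (g \<otimes> h) \<otimes>\<^bsub>E\<^esub> k (g \<otimes> h) \<otimes>\<^bsub>E\<^esub> inv\<^bsub>E\<^esub> ?t (g \<otimes> h)"
    have wk: "?w \<otimes>\<^bsub>E\<^esub> k h \<in> M" using w kc(2) by (rule subgroup.m_closed[OF M])
    have "?z \<otimes>\<^bsub>E\<^esub> (?t (g \<otimes> h) \<otimes>\<^bsub>E\<^esub> k (g \<otimes> h)) = ?t g \<otimes>\<^bsub>E\<^esub> k g \<otimes>\<^bsub>E\<^esub> (?t h \<otimes>\<^bsub>E\<^esub> k h)"
      using u_mult[OF g h] by (simp only: u_eq g h m_closed)
    moreover have "?z \<otimes>\<^bsub>E\<^esub> ?v' = ?z \<otimes>\<^bsub>E\<^esub> (?t (g \<otimes> h) \<otimes>\<^bsub>E\<^esub> k (g \<otimes> h)) \<otimes>\<^bsub>E\<^esub> inv\<^bsub>E\<^esub> ?t (g \<otimes> h)"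
      using cl kE M_carrier[OF z] by (simp add: E.m_assoc)
    ultimately have "?z \<otimes>\<^bsub>E\<^esub> ?v' = ?t g \<otimes>\<^bsub>E\<^esub> k g \<otimes>\<^bsub>E\<^esub> (?t h \<otimes>\<^bsub>E\<^esub> k h) \<otimes>\<^bsub>E\<^esub> inv\<^bsub>E\<^esub> ?t (g \<otimes> h)"
      by simp
    also have "\<dots> = ?b \<otimes>\<^bsub>E\<^esub> ?v"
      using cl kE by (simp add: E.m_assoc)
    finally have "\<phi> (?z \<otimes>\<^bsub>E\<^esub> ?v') = \<phi> (?b \<otimes>\<^bsub>E\<^esub> ?v)" by simp
    moreover have "\<phi> (?z \<otimes>\<^bsub>E\<^esub> ?v') = f (g, h) ^ n * c (g \<otimes> h)"
      using \<phi>_mult[OF z M_conj[OF cl(3) kc(3)]] \<phi>_conj[OF cl(3) kc(3)] \<phi>_scalar[of "f (g, h)"] g h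
      by (simp add: c_def)
    moreover have "\<phi> (?b \<otimes>\<^bsub>E\<^esub> ?v) = \<phi> ?b * (\<phi> (k g) * \<phi> (k h))"
      using \<phi>_mult[OF b M_conj[OF cl(3) wk]] \<phi>_conj[OF cl(3) wk] \<phi>_mult[OF w kc(2)]
        \<phi>_conj[OF E.inv_closed[OF cl(2)] kc(1)]
      by simp
    moreover have "\<phi> ?b = \<beta> (S #> g, S #> h)"
      using g h by (simp add: \<beta>_def coset_closed coset_mult)
    ultimately show ?thesis by (simp add: c_def)
  qed
  have \<beta>_eq: "\<beta> (S #> g, S #> h) = f (g, h) ^ n * c (g \<otimes> h) / (c g * c h)"
    if "g \<in> carrier G" "h \<in> carrier G" for g h
    using main[OF that] c_nz that by (simp add: field_simps)
  text \<open>Inflated to \<open>G\<close>, \<open>\<beta>\<close> is \<open>f ^ n\<close> divided by the coboundary of \<open>c\<close>, so the cocycle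
    identity for \<open>\<beta>\<close> is inherited from \<open>f\<close>.\<close>
  have "\<beta> \<in> cocycles2 (G Mod S)"
    unfolding cocycles2_iff
  proof (intro conjI ballI)
    show "\<beta> \<in> extensional (carrier (G Mod S) \<times> carrier (G Mod S))" by (simp add: \<beta>_def)
  next
    fix q1 q2 assume "q1 \<in> carrier (G Mod S)" "q2 \<in> carrier (G Mod S)"
    then show "\<beta> (q1, q2) \<noteq> 0" using c_nz by (auto simp: carrier_FactGroup \<beta>_eq)
  next
    fix q1 q2 q3 assume "q1 \<in> carrier (G Mod S)" "q2 \<in> carrier (G Mod S)" "q3 \<in> carrier (G Mod S)"
    then obtain x y z where xyz: "q1 = S #> x" "q2 = S #> y" "q3 = S #> z"
      "x \<in> carrier G" "y \<in> carrier G" "z \<in> carrier G"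
      by (auto simp: carrier_FactGroup)
    have xy: "q1 \<otimes>\<^bsub>G Mod S\<^esub> q2 = S #> (x \<otimes> y)" and yz: "q2 \<otimes>\<^bsub>G Mod S\<^esub> q3 = S #> (y \<otimes> z)"
      using coset_mult xyz by simp_all
    have cnz: "c x \<noteq> 0" "c y \<noteq> 0" "c z \<noteq> 0" "c (x \<otimes> y) \<noteq> 0" "c (y \<otimes> z) \<noteq> 0"
      using c_nz xyz by simp_all
    have "\<beta> (q2, q3) * \<beta> (q1, S #> (y \<otimes> z)) =
        (f (y, z) * f (x, y \<otimes> z)) ^ n * (c (x \<otimes> (y \<otimes> z)) / (c x * c y * c z))"
      using cnz xyz by (simp add: \<beta>_eq power_mult_distrib mult_ac)
    also have "f (y, z) * f (x, y \<otimes> z) = f (x \<otimes> y, z) * f (x, y)"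
      using f_cocycle xyz by simp
    also have "x \<otimes> (y \<otimes> z) = x \<otimes> y \<otimes> z"
      using xyz by (simp add: m_assoc)
    also have "(f (x \<otimes> y, z) * f (x, y)) ^ n * (c (x \<otimes> y \<otimes> z) / (c x * c y * c z)) =
        \<beta> (S #> (x \<otimes> y), q3) * \<beta> (q1, q2)"
      using cnz xyz by (simp add: \<beta>_eq power_mult_distrib mult_ac)
    finally show "\<beta> (q2, q3) * \<beta> (q1, q2 \<otimes>\<^bsub>G Mod S\<^esub> q3) = \<beta> (q1 \<otimes>\<^bsub>G Mod S\<^esub> q2, q3) * \<beta> (q1, q2)"
      unfolding xy yz .
  qed
  then show thesis
  proof (rule that[rotated])
    show "f (g, h) ^ n = \<beta> (S #> g, S #> h) * (c g * c h / c (g \<otimes> h))"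
      if "g \<in> carrier G" "h \<in> carrier G" for g h
      using main[OF that] c_nz[of "g \<otimes> h"] that by (simp add: field_simps)
  qed (rule c_nz)
qed

end

text \<open>Up to a coboundary \<open>f ^ n\<close> is inflated from the quotient, whose Schur
  multiplier is killed by its exponent.\<close>

lemma (in group) pow_coboundary_if_central_power_map:
  assumes f: "f \<in> cocycles2 G" and S: "S \<lhd> G"
    and pow_snd: "\<And>x. \<lbrakk>x \<in> carrier (cocycle_extension G f); snd x \<in> S\<rbrakk> \<Longrightarrow>
      snd (x [^]\<^bsub>cocycle_extension G f\<^esub> n) = \<one>"
    and pow_mult: "\<And>x y. \<lbrakk>x \<in> carrier (cocycle_extension G f); y \<in> carrier (cocycle_extension G f);
      snd x \<in> S; snd y \<in> S\<rbrakk> \<Longrightarrow>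
      (x \<otimes>\<^bsub>cocycle_extension G f\<^esub> y) [^]\<^bsub>cocycle_extension G f\<^esub> (n::nat) =
      x [^]\<^bsub>cocycle_extension G f\<^esub> n \<otimes>\<^bsub>cocycle_extension G f\<^esub> y [^]\<^bsub>cocycle_extension G f\<^esub> n"
  shows "(\<lambda>p\<in>carrier G \<times> carrier G. f p ^ (n * group_exponent (schur_multiplier (G Mod S))))
    \<in> coboundaries2 G"
proof -
  interpret two_cocycle G f by unfold_locales (rule f)
  interpret S: normal S G by (rule S)
  interpret Q: group "G Mod S" by (rule S.factorgroup_is_group)
  let ?m = "group_exponent (schur_multiplier (G Mod S))"
  obtain c \<beta> where c: "\<And>g. g \<in> carrier G \<Longrightarrow> c g \<noteq> 0" and \<beta>: "\<beta> \<in> cocycles2 (G Mod S)"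
    and eq: "\<And>g h. \<lbrakk>g \<in> carrier G; h \<in> carrier G\<rbrakk> \<Longrightarrow>
      f (g, h) ^ n = \<beta> (S #> g, S #> h) * (c g * c h / c (g \<otimes> h))"
    using cocycle_pow_inflated[OF S pow_snd pow_mult] by blast
  \<comment> \<open>This also covers the default exponent 0, where the power is constantly
    1.\<close>
  have "(\<lambda>p\<in>carrier (G Mod S) \<times> carrier (G Mod S). \<beta> p ^ ?m) \<in> coboundaries2 (G Mod S)"
    using Q.group_exponent_schur_multiplier_dvd_iff[of ?m] \<beta> by auto
  then obtain d where d: "\<And>q1. q1 \<in> carrier (G Mod S) \<Longrightarrow> d q1 \<noteq> 0"
    "\<And>q1 q2. \<lbrakk>q1 \<in> carrier (G Mod S); q2 \<in> carrier (G Mod S)\<rbrakk> \<Longrightarrow>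
      \<beta> (q1, q2) ^ ?m = d q1 * d q2 / d (q1 \<otimes>\<^bsub>G Mod S\<^esub> q2)"
    unfolding Q.coboundaries2_iff by force
  \<comment> \<open>The \<open>?m\<close>-th power of \<open>c\<close> times the inflation of
    \<open>d\<close>.\<close>
  define b where "b g = c g ^ ?m * d (S #> g)" for g
  have cl: "S #> g \<in> carrier (G Mod S)" if "g \<in> carrier G" for g
    using that by (auto simp: carrier_FactGroup)
  have "b g \<noteq> 0" if "g \<in> carrier G" for g
    using c d(1) cl that by (simp add: b_def)
  moreover have "f (g, h) ^ (n * ?m) = b g * b h / b (g \<otimes> h)"
    if "g \<in> carrier G" "h \<in> carrier G" for g h
  proof -
    have "f (g, h) ^ (n * ?m) = \<beta> (S #> g, S #> h) ^ ?m * (c g * c h / c (g \<otimes> h)) ^ ?m"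
      by (simp only: power_mult eq[OF that] power_mult_distrib)
    also have "\<dots> = b g * b h / b (g \<otimes> h)"
      using that by (simp add: d(2) cl b_def S.rcos_sum power_mult_distrib power_divide mult_ac)
    finally show ?thesis .
  qed
  ultimately show ?thesis
    unfolding coboundaries2_iff by auto
qed

section \<open>The exponent of the Schur multiplier\<close>

theorem mainTheorem9:
  fixes G :: "('a, 'b) monoid_scheme"
    and N :: "nat \<Rightarrow> 'a set"
    and r :: nat
    and I :: "nat set"
  assumes "group G" and "finite (carrier G)" and "\<exists>m::nat. order G = 2 ^ m"
    and "r \<ge> 1"
    and "N 0 = carrier G" and "N r = {\<one>\<^bsub>G\<^esub>}"
    and "\<And>i. i \<in> {1..r} \<Longrightarrow> N i \<subset> N (i - 1)"
    and "\<And>i. i \<in> {1..r} \<Longrightarrow> N i \<lhd> G\<lparr>carrier := N (i - 1)\<rparr>"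
    and "\<And>i. i \<in> {1..r} \<Longrightarrow> comm_group (series_factor G N i)"
    and "I = {k \<in> {2..r}. \<exists>H. subgroup H (series_factor G N k) \<and>
           (series_factor G N k)\<lparr>carrier := H\<rparr> \<cong>
             integer_mod_group (group_exponent (series_factor G N k)) \<times>\<times>
             integer_mod_group (group_exponent (series_factor G N k))}"
  shows "group_exponent (schur_multiplier G) dvd
           2 ^ card I * (\<Prod>j = 2..r. group_exponent (series_factor G N j)) *
           group_exponent (schur_multiplier (series_factor G N 1))"
proof -
  interpret group G by fact
  obtain m where m: "order G = 2 ^ m" using assms(3) by blast
  define n where "n = (\<Prod>j=2..r. (if has_exponent_square (series_factor G N j) then 2 else 1) *
    group_exponent (series_factor G N j))"
  have I: "I = {j \<in> {2..r}. has_exponent_square (series_factor G N j)}"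
    using assms(10) by (simp add: has_exponent_square_def)
  \<comment> \<open>Each index in \<open>I\<close> contributes exactly one factor 2.\<close>
  have "(\<Prod>j=2..r. if has_exponent_square (series_factor G N j) then 2 else 1) = (2::nat) ^ card I"
    by (simp add: I flip: prod.inter_filter)
  then have n: "n = 2 ^ card I * (\<Prod>j = 2..r. group_exponent (series_factor G N j))"
    by (simp add: n_def prod.distrib)
  have sub: "subgroup (N i) G" if "i \<le> r" for i
    using that
  proof (induction i)
    case 0
    then show ?case using assms(5) subgroup_self by simp
  next
    case (Suc i)
    then show ?case
      using incl_subgroup[of "N i" "N (Suc i)"] assms(8)[of "Suc i"] normal_imp_subgroup by force
  qed
  \<comment> \<open>Since \<open>N 0\<close> is the whole group, \<open>N 1\<close> is normal in
    \<open>G\<close> itself, so inflation from the first factor makes sense.\<close>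
  have N1: "N 1 \<lhd> G" and Q1: "series_factor G N 1 = G Mod N 1"
    using assms(8)[of 1] assms(4,5) by (simp_all add: series_factor_def)
  show ?thesis
    unfolding n[symmetric] Q1 group_exponent_schur_multiplier_dvd_iff
  proof
    fix f assume f: "f \<in> cocycles2 G"
    then interpret two_cocycle G f by unfold_locales
    have "g [^]\<^bsub>G\<^esub> ((2::nat) ^ m) = \<one>\<^bsub>G\<^esub>" if "g \<in> carrier G" for g
      using pow_order_eq_1[OF that] m by simp
    note pow = group_hom.subnormal_central_power_map[OF group_hom_snd kernel_central this sub
        assms(6,4,8,9) n_def]
    show "(\<lambda>p\<in>carrier G \<times> carrier G.
        f p ^ (n * group_exponent (schur_multiplier (G Mod N 1)))) \<in> coboundaries2 G"
      by (rule pow_coboundary_if_central_power_map[OF f N1]) (use pow in \<open>simp_all del: carrier_E\<close>)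
  qed
qed

end
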